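(* Let $\Theta$ be a finite simple oriented graph with vertex set $V_\Theta=\{x_1,\dots,x_n\}$, $n\ge 1$. For an endomorphism $\varphi$ of the monoid $\mathbf{HK}_\Theta$ put $\Phi(\varphi)=(c(\varphi(x_1)),\dots,c(\varphi(x_n)))$, and for a sequence $(X_1,\dots,X_n)$ of subsets of $V_\Theta$ let $\Psi(X_1,\dots,X_n)$ be the $n\times n$ Boolean matrix whose $(i,j)$ entry is $1$ if $x_i\in X_j$ and $0$ otherwise. Let $\widetilde{\mathcal S}_{\Theta,\Theta}$ be the set of $(\Theta,\Theta)$-admissible sequences. Then the set $\Psi(\widetilde{\mathcal S}_{\Theta,\Theta})$, equipped with the Boolean matrix product $\cdot$, is a monoid, and $$\mathrm{End}(\mathbf{HK}_\Theta)\cong(\Psi(\widetilde{\mathcal S}_{\Theta,\Theta}),\cdot),$$ where the corresponding monoid isomorphism is given by $\Psi\circ\Phi$.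
   Context: A finite simple oriented graph is a finite directed graph with no multiple arrows, no loops and no oriented cycles of length $2$. Write $x_i\overset{\Theta}{\to}x_j$ if there is an arrow from $x_i$ to $x_j$ in $\Theta$. Distinct vertices are not connected if there is no arrow between them in either direction. The Hecke--Kiselman monoid $\mathbf{HK}_\Theta$ is the monoid generated by $x_1,\dots,x_n$ subject to the relations: $x_i^2=x_i$; $x_ix_j=x_jx_i$ if $x_i,x_j$ are not connected in $\Theta$; $x_ix_jx_i=x_jx_ix_j=x_ix_j$ if $x_i\overset{\Theta}{\to}x_j$. $\mathrm{End}(\mathbf{HK}_\Theta)$ is the monoid of (identity-preserving) monoid endomorphisms of $\mathbf{HK}_\Theta$ under composition of maps, $(\psi\circ\varphi)(x)=\psi(\varphi(x))$. The content $c(x)\subseteq V_\Theta$ of $x\in\mathbf{HK}_\Theta$ is the set of letters (vertices) occurring in any word in the generators that represents $x$; it is independent of the word because the relations preserve the set of occurring letters. For $X\subseteq V_\Theta$, $\Theta[X]$ is the full (induced) subgraph of $\Theta$ on $X$, and $\mathcal A_\Theta$ is the set of $X\subseteq V_\Theta$ such that $\Theta[X]$ contains no oriented cycles. For $X,Y\in\mathcal A_\Theta$, the condition $p_\Theta(X,Y)$ holds if and only if there do not exist $x_b\in Y\setminus X$, $x_a\in X\setminus Y$, an integer $r\ge 0$ and $x_{i_1},\dots,x_{i_r}\in X\cap Y$ with $x_b\overset{\Theta}{\to}x_{i_1}\overset{\Theta}{\to}\cdots\overset{\Theta}{\to}x_{i_r}\overset{\Theta}{\to}x_a$ (for $r=0$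 this chain means $x_b\overset{\Theta}{\to}x_a$). A sequence $(X_1,\dots,X_n)$ of subsets of $V_\Theta$ is $(\Theta,\Theta)$-admissible if for all $i,j\in\{1,\dots,n\}$: (i) $X_i\in\mathcal A_\Theta$; (ii) $p_\Theta(X_i,X_j)$ and $p_\Theta(X_j,X_i)$ both hold if $x_i$ and $x_j$ are not connected in $\Theta$; (iii) $p_\Theta(X_i,X_j)$ holds if $x_i\overset{\Theta}{\to}x_j$. The product of $n\times n$ Boolean matrices ($0$/$1$ matrices) is $(A\cdot B)_{i,j}=\bigvee_{k=1}^n(A_{i,k}\wedge B_{k,j})$, where $\vee,\wedge$ are Boolean join and meet on $\{0,1\}$. *)

theory Defs
  imports
    "HOL-Algebra.Group"
    "Jordan_Normal_Form.Matrix"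
    "Graph_Theory.Arc_Walk"
    "Graph_Theory.Digraph_Component"
begin

section \<open>Finite simple oriented graphs\<close>

text \<open>The locale \<open>digraph\<close> already provides finiteness and excludes loops and multiple arrows.\<close>

locale oriented_graph = digraph +
  assumes no_two_cycles: "u \<rightarrow>\<^bsub>G\<^esub> v \<Longrightarrow> \<not> v \<rightarrow>\<^bsub>G\<^esub> u"

definition not_connected :: "('a, 'b) pre_digraph \<Rightarrow> 'a \<Rightarrow> 'a \<Rightarrow> bool" where
  "not_connected \<Theta> u v \<longleftrightarrow>
     u \<in> verts \<Theta> \<and> v \<in> verts \<Theta> \<and> u \<noteq> v \<and> \<not> u \<rightarrow>\<^bsub>\<Theta>\<^esub> v \<and> \<not> v \<rightarrow>\<^bsub>\<Theta>\<^esub> u"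

section \<open>The Hecke-Kiselman monoid\<close>

text \<open>The least congruence on the free monoid of words over the vertices that contains the
  defining relations.\<close>

inductive_set hk_cong :: "('a, 'b) pre_digraph \<Rightarrow> ('a list \<times> 'a list) set"
  for \<Theta> :: "('a, 'b) pre_digraph"
  where
    idem: "u \<in> verts \<Theta> \<Longrightarrow> ([u, u], [u]) \<in> hk_cong \<Theta>"
  | comm: "not_connected \<Theta> u v \<Longrightarrow> ([u, v], [v, u]) \<in> hk_cong \<Theta>"
  | arrow1: "u \<in> verts \<Theta> \<Longrightarrow> v \<in> verts \<Theta> \<Longrightarrow> u \<rightarrow>\<^bsub>\<Theta>\<^esub> v \<Longrightarrow> ([u, v, u], [u, v]) \<in> hk_cong \<Theta>"
  | arrow2: "u \<in> verts \<Theta> \<Longrightarrow> v \<in> verts \<Theta> \<Longrightarrow> u \<rightarrow>\<^bsub>\<Theta>\<^esub> v \<Longrightarrow> ([v, u, v], [u, v]) \<in> hk_cong \<Theta>"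
  | refl: "w \<in> lists (verts \<Theta>) \<Longrightarrow> (w, w) \<in> hk_cong \<Theta>"
  | sym: "(v, w) \<in> hk_cong \<Theta> \<Longrightarrow> (w, v) \<in> hk_cong \<Theta>"
  | trans: "(u, v) \<in> hk_cong \<Theta> \<Longrightarrow> (v, w) \<in> hk_cong \<Theta> \<Longrightarrow> (u, w) \<in> hk_cong \<Theta>"
  | mult: "(v, w) \<in> hk_cong \<Theta> \<Longrightarrow> a \<in> lists (verts \<Theta>) \<Longrightarrow> b \<in> lists (verts \<Theta>) \<Longrightarrow>
      (a @ v @ b, a @ w @ b) \<in> hk_cong \<Theta>"

definition hk_class :: "('a, 'b) pre_digraph \<Rightarrow> 'a list \<Rightarrow> 'a list set" where
  "hk_class \<Theta> w = hk_cong \<Theta> `` {w}"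

definition HK :: "('a, 'b) pre_digraph \<Rightarrow> 'a list set monoid" where
  "HK \<Theta> = \<lparr> carrier = lists (verts \<Theta>) // hk_cong \<Theta>,
            mult = (\<lambda>P Q. \<Union>v\<in>P. \<Union>w\<in>Q. hk_class \<Theta> (v @ w)),
            one = hk_class \<Theta> [] \<rparr>"

definition hk_gen :: "('a, 'b) pre_digraph \<Rightarrow> 'a \<Rightarrow> 'a list set" where
  "hk_gen \<Theta> u = hk_class \<Theta> [u]"

text \<open>An element of the monoid is the set of all words representing it; by the lemma
  \<open>content_hk_class\<close> below, every single representative already gives the whole union.\<close>

definition content :: "'a list set \<Rightarrow> 'a set" where
  "content P = (\<Union>w\<in>P. set w)"

lemma hk_cong_lists:
  "(v, w) \<in> hk_cong \<Theta> \<Longrightarrow> v \<in> lists (verts \<Theta>) \<and> w \<in> lists (verts \<Theta>)"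
  by (induction rule: hk_cong.induct) (auto simp: not_connected_def)

lemma hk_cong_set: "(v, w) \<in> hk_cong \<Theta> \<Longrightarrow> set v = set w"
  by (induction rule: hk_cong.induct) auto

lemma equiv_hk_cong: "equiv (lists (verts \<Theta>)) (hk_cong \<Theta>)"
proof (rule equivI)
  show "hk_cong \<Theta> \<subseteq> lists (verts \<Theta>) \<times> lists (verts \<Theta>)"
    by (auto dest: hk_cong_lists)
  show "refl_on (lists (verts \<Theta>)) (hk_cong \<Theta>)"
    by (auto simp: refl_on_def intro: hk_cong.refl)
  show "Relation.sym (hk_cong \<Theta>)"
    by (auto intro: symI hk_cong.sym)
  show "Relation.trans (hk_cong \<Theta>)"
    by (rule transI) (rule hk_cong.trans)
qed

lemma hk_class_eqI: "(v, w) \<in> hk_cong \<Theta> \<Longrightarrow> hk_class \<Theta> v = hk_class \<Theta> w"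
  unfolding hk_class_def by (rule equiv_class_eq[OF equiv_hk_cong])

lemma hk_class_self: "w \<in> lists (verts \<Theta>) \<Longrightarrow> w \<in> hk_class \<Theta> w"
  by (simp add: hk_class_def hk_cong.refl)

lemma content_hk_class: "w \<in> lists (verts \<Theta>) \<Longrightarrow> content (hk_class \<Theta> w) = set w"
  using hk_class_self[of w \<Theta>] unfolding content_def
  by (auto simp: hk_class_def dest: hk_cong_set)

lemma hk_cong_append:
  assumes "(v, v') \<in> hk_cong \<Theta>" "(w, w') \<in> hk_cong \<Theta>"
  shows "(v @ w, v' @ w') \<in> hk_cong \<Theta>"
proof -
  have l: "v' \<in> lists (verts \<Theta>)" "w \<in> lists (verts \<Theta>)"
    using hk_cong_lists[OF assms(1)] hk_cong_lists[OF assms(2)] by blast+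
  have "(v @ w, v' @ w) \<in> hk_cong \<Theta>"
    using hk_cong.mult[OF assms(1), of "[]" w] l(2) by simp
  moreover have "(v' @ w, v' @ w') \<in> hk_cong \<Theta>"
    using hk_cong.mult[OF assms(2), of v' "[]"] l(1) by simp
  ultimately show ?thesis by (rule hk_cong.trans)
qed

lemma carrier_HK: "carrier (HK \<Theta>) = hk_class \<Theta> ` lists (verts \<Theta>)"
  by (auto simp: HK_def quotient_def hk_class_def)

lemma one_HK: "\<one>\<^bsub>HK \<Theta>\<^esub> = hk_class \<Theta> []"
  by (simp add: HK_def)

lemma mult_hk_class:
  assumes "v \<in> lists (verts \<Theta>)" "w \<in> lists (verts \<Theta>)"
  shows "hk_class \<Theta> v \<otimes>\<^bsub>HK \<Theta>\<^esub> hk_class \<Theta> w = hk_class \<Theta> (v @ w)"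
proof -
  have "hk_class \<Theta> (v' @ w') = hk_class \<Theta> (v @ w)"
    if "v' \<in> hk_class \<Theta> v" "w' \<in> hk_class \<Theta> w" for v' w'
    using that by (intro hk_class_eqI hk_cong_append) (auto simp: hk_class_def intro: hk_cong.sym)
  moreover have "v \<in> hk_class \<Theta> v" "w \<in> hk_class \<Theta> w"
    using assms by (simp_all add: hk_class_self)
  ultimately have "(\<Union>v'\<in>hk_class \<Theta> v. \<Union>w'\<in>hk_class \<Theta> w. hk_class \<Theta> (v' @ w')) = hk_class \<Theta> (v @ w)"
    by blast
  then show ?thesis
    by (simp add: HK_def)
qed

lemma monoid_HK: "monoid (HK \<Theta>)"
proof (rule monoidI, unfold carrier_HK one_HK, goal_cases)
  case (1 P Q)
  then show ?case
    by (elim imageE) (simp add: mult_hk_class append_in_lists_conv del: in_lists_conv_set)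
next
  case 2
  show ?case by (rule imageI) simp
next
  case (3 P Q R)
  then show ?case
    by (elim imageE) (simp add: mult_hk_class append_in_lists_conv del: in_lists_conv_set)
next
  case (4 P)
  then show ?case
    by (elim imageE) (simp add: mult_hk_class lists.Nil del: in_lists_conv_set)
next
  case (5 P)
  then show ?case
    by (elim imageE) (simp add: mult_hk_class lists.Nil del: in_lists_conv_set)
qed

section \<open>Endomorphism monoids\<close>

text \<open>As for \<open>BijGroup\<close>, maps are normalized to be \<open>undefined\<close> outside the carrier, so that
  equality of endomorphisms is equality on the carrier. The elements of \<open>hom\<close> need not preserve
  the identity, whence the additional condition.\<close>

definition End_monoid :: "('a, 'm) monoid_scheme \<Rightarrow> ('a \<Rightarrow> 'a) monoid" where
  "End_monoid M =
     \<lparr> carrier = {\<phi> \<in> hom M M \<inter> extensional (carrier M). \<phi> \<one>\<^bsub>M\<^esub> = \<one>\<^bsub>M\<^esub>},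
       mult = (\<lambda>\<psi> \<phi>. compose (carrier M) \<psi> \<phi>),
       one = (\<lambda>x\<in>carrier M. x) \<rparr>"

lemma monoid_End_monoid:
  assumes "monoid M"
  shows "monoid (End_monoid M)"
proof -
  interpret monoid M by (rule assms)
  let ?C = "carrier M"
  have mem: "\<phi> \<in> carrier (End_monoid M) \<longleftrightarrow>
      \<phi> \<in> hom M M \<and> \<phi> \<in> extensional ?C \<and> \<phi> \<one>\<^bsub>M\<^esub> = \<one>\<^bsub>M\<^esub>" for \<phi>
    by (simp add: End_monoid_def)
  have mult: "\<psi> \<otimes>\<^bsub>End_monoid M\<^esub> \<phi> = compose ?C \<psi> \<phi>" for \<psi> \<phi>
    by (simp add: End_monoid_def)
  have one: "\<one>\<^bsub>End_monoid M\<^esub> = (\<lambda>x\<in>?C. x)"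
    by (simp add: End_monoid_def)
  have funcset: "\<phi> \<in> ?C \<rightarrow> ?C" if "\<phi> \<in> hom M M" for \<phi>
    using that by (simp add: hom_def)
  show ?thesis
  proof (rule monoidI, unfold mem mult one, goal_cases)
    case (1 \<psi> \<phi>)
    then have "compose ?C \<psi> \<phi> \<in> hom M M"
      by (auto simp: hom_def compose_def Pi_def)
    moreover have "compose ?C \<psi> \<phi> \<one>\<^bsub>M\<^esub> = \<one>\<^bsub>M\<^esub>"
      using 1 by (simp add: compose_def)
    ultimately show ?case by (simp add: compose_extensional)
  next
    case 2
    have "(\<lambda>x\<in>?C. x) \<in> hom M M" by (rule homI) simp_all
    then show ?case by simp
  next
    case (3 \<chi> \<psi> \<phi>)
    then show ?case by (metis compose_assoc funcset)
  next
    case (4 \<phi>)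
    then show ?case by (metis Id_compose funcset)
  next
    case (5 \<phi>)
    then show ?case by (metis compose_Id funcset)
  qed
qed

section \<open>Admissible sequences\<close>

definition acyclic_sets :: "('a, 'b) pre_digraph \<Rightarrow> 'a set set" where
  "acyclic_sets \<Theta> = {X. X \<subseteq> verts \<Theta> \<and> (\<nexists>c. pre_digraph.cycle (induce_subgraph \<Theta> X) c)}"

definition p_cond :: "('a, 'b) pre_digraph \<Rightarrow> 'a set \<Rightarrow> 'a set \<Rightarrow> bool" where
  "p_cond \<Theta> X Y \<longleftrightarrow>
     \<not> (\<exists>b \<in> Y - X. \<exists>a \<in> X - Y. \<exists>cs. set cs \<subseteq> X \<inter> Y \<and>
          successively (\<lambda>u v. u \<rightarrow>\<^bsub>\<Theta>\<^esub> v) (b # cs @ [a]))"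

text \<open>Vertices are enumerated as \<open>x 0, \<dots>, x (n - 1)\<close>, and a sequence of \<open>n\<close> subsets is a list of
  length \<open>n\<close>; all indices start from 0.\<close>

definition admissible :: "('a, 'b) pre_digraph \<Rightarrow> (nat \<Rightarrow> 'a) \<Rightarrow> nat \<Rightarrow> 'a set list set" where
  "admissible \<Theta> x n = {Xs. length Xs = n \<and>
     (\<forall>i<n. \<forall>j<n.
        Xs ! i \<in> acyclic_sets \<Theta> \<and>
        (not_connected \<Theta> (x i) (x j) \<longrightarrow>
           p_cond \<Theta> (Xs ! i) (Xs ! j) \<and> p_cond \<Theta> (Xs ! j) (Xs ! i)) \<and>
        (x i \<rightarrow>\<^bsub>\<Theta>\<^esub> x j \<longrightarrow> p_cond \<Theta> (Xs ! i) (Xs ! j)))}"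

section \<open>Boolean matrices\<close>

text \<open>The entries 0 and 1 are \<open>False\<close> and \<open>True\<close>. The type \<open>bool\<close> carries no semiring structure,
  so the product of \<open>Jordan_Normal_Form.Matrix\<close> is not available for these matrices.\<close>

definition bool_mat_mult :: "bool mat \<Rightarrow> bool mat \<Rightarrow> bool mat" where
  "bool_mat_mult A B =
     mat (dim_row A) (dim_col B) (\<lambda>(i, j). \<exists>k<dim_col A. A $$ (i, k) \<and> B $$ (k, j))"

definition bool_mat_one :: "nat \<Rightarrow> bool mat" where
  "bool_mat_one n = mat n n (\<lambda>(i, j). i = j)"

definition bool_mat_monoid :: "nat \<Rightarrow> bool mat set \<Rightarrow> bool mat monoid" where
  "bool_mat_monoid n S = \<lparr> carrier = S, mult = bool_mat_mult, one = bool_mat_one n \<rparr>"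

section \<open>The maps \<open>\<Phi>\<close> and \<open>\<Psi>\<close>\<close>

definition Phi ::
  "('a, 'b) pre_digraph \<Rightarrow> (nat \<Rightarrow> 'a) \<Rightarrow> nat \<Rightarrow> ('a list set \<Rightarrow> 'a list set) \<Rightarrow> 'a set list" where
  "Phi \<Theta> x n \<phi> = map (\<lambda>i. content (\<phi> (hk_gen \<Theta> (x i)))) [0..<n]"

definition Psi :: "(nat \<Rightarrow> 'a) \<Rightarrow> nat \<Rightarrow> 'a set list \<Rightarrow> bool mat" where
  "Psi x n Xs = mat n n (\<lambda>(i, j). x i \<in> Xs ! j)"

end

theory Submission
  imports Defs
begin

text \<open>For acyclic \<open>X\<close> a topologically sorted word of \<open>X\<close> represents a zero of the submonoid generated
  by \<open>X\<close>, and it is the only idempotent with content \<open>X\<close>; sets with cycles are not contents of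
  idempotents. Since endomorphisms map generators to idempotents, they are determined by the contents
  of these images. The defining relations between two idempotents with contents \<open>X\<close> and \<open>Y\<close>
  reduce to the idempotency of their product, which is equivalent to \<open>p_cond \<Theta> X Y\<close>. Negative facts
  about words are obtained from actions of the monoid by local updates of vertex states.\<close>

section \<open>Oriented cycles and acyclic relations\<close>

lemma (in wf_digraph) ex_cycle_iff: "(\<exists>c. cycle c) \<longleftrightarrow> \<not> acyclic (arcs_ends G)"
proof -
  have "(\<exists>c. cycle c) \<longleftrightarrow> (\<exists>c. closed_w c)"
    using closed_w_imp_cycle by (auto simp: cycle_altdef)
  also have "\<dots> \<longleftrightarrow> (\<exists>u. u \<rightarrow>\<^sup>+\<^bsub>G\<^esub> u)"
    by (auto simp: closed_w_def reachable1_awalk)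
  finally show ?thesis by (simp add: acyclic_def)
qed

context oriented_graph
begin

section \<open>The congruence on words\<close>

definition cong :: "'a list \<Rightarrow> 'a list \<Rightarrow> bool" (infix \<open>\<approx>\<close> 50) where
  "v \<approx> w \<longleftrightarrow> (v, w) \<in> hk_cong G"

lemma cong_idem: "u \<in> verts G \<Longrightarrow> [u, u] \<approx> [u]"
  and cong_comm: "not_connected G u v \<Longrightarrow> [u, v] \<approx> [v, u]"
  and cong_arrow1: "u \<in> verts G \<Longrightarrow> v \<in> verts G \<Longrightarrow> u \<rightarrow>\<^bsub>G\<^esub> v \<Longrightarrow> [u, v, u] \<approx> [u, v]"
  and cong_arrow2: "u \<in> verts G \<Longrightarrow> v \<in> verts G \<Longrightarrow> u \<rightarrow>\<^bsub>G\<^esub> v \<Longrightarrow> [v, u, v] \<approx> [u, v]"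
  and cong_refl: "set w \<subseteq> verts G \<Longrightarrow> w \<approx> w"
  and cong_sym: "w1 \<approx> w2 \<Longrightarrow> w2 \<approx> w1"
  and cong_trans [trans]: "w1 \<approx> w2 \<Longrightarrow> w2 \<approx> w3 \<Longrightarrow> w1 \<approx> w3"
  by (auto simp: cong_def intro: hk_cong.intros)

lemma cong_set: "v \<approx> w \<Longrightarrow> set v = set w"
  unfolding cong_def by (rule hk_cong_set)

lemma cong_context:
  assumes "v \<approx> w" "set a \<subseteq> verts G" "set b \<subseteq> verts G"
  shows "a @ v @ b \<approx> a @ w @ b"
  using assms by (auto simp: cong_def intro: hk_cong.mult)

lemma hk_class_eq_iff:
  assumes "set v \<subseteq> verts G" "set w \<subseteq> verts G"
  shows "hk_class G v = hk_class G w \<longleftrightarrow> v \<approx> w"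
  unfolding hk_class_def cong_def
  by (rule eq_equiv_class_iff[OF equiv_hk_cong]) (use assms in auto)

text \<open>Erasing letters turns each defining relation into a defining relation or a trivial one;
  erasing \<open>v\<close> from an arrow relation, for instance, leaves an instance of idempotency
  or of reflexivity.\<close>

lemma cong_filter: "v \<approx> w \<Longrightarrow> filter P v \<approx> filter P w"
  unfolding cong_def
proof (induction rule: hk_cong.induct)
  case (comm u v)
  then show ?case
    by (auto intro: hk_cong.comm hk_cong.refl simp: not_connected_def)
next
  case (sym v w)
  show ?case using sym.IH by (rule hk_cong.sym)
next
  case (trans u v w)
  show ?case by (rule hk_cong.trans[OF trans.IH])
next
  case (mult v w a b)
  then show ?case by (auto intro!: hk_cong.mult)
qed (auto intro: hk_cong.intros)

section \<open>Absorption of letters\<close>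

text \<open>The leading \<open>v\<close> can be carried through \<open>u\<close> to meet the final
  one: it commutes with an unconnected letter \<open>y\<close>, and for an arrow from
  \<open>v\<close> to \<open>y\<close> the relation \<open>[v, y]\<close> \<approx>
  \<open>[v, y, v]\<close> creates a copy behind \<open>y\<close>.\<close>

lemma absorb_right:
  assumes "v \<in> verts G" "set u \<subseteq> verts G" "\<And>y. y \<in> set u \<Longrightarrow> \<not> y \<rightarrow>\<^bsub>G\<^esub> v"
  shows "v # u @ [v] \<approx> v # u"
  using assms(2,3)
proof (induction u)
  case Nil
  then show ?case using assms(1) by (auto intro: cong_idem)
next
  case (Cons y u)
  have y: "y \<in> verts G" "\<not> y \<rightarrow>\<^bsub>G\<^esub> v" and u: "set u \<subseteq> verts G"
    using Cons.prems by auto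
  have IH: "v # u @ [v] \<approx> v # u"
    using Cons by auto
  consider "y = v" | "v \<rightarrow>\<^bsub>G\<^esub> y" | "not_connected G v y"
    using y assms(1) by (auto simp: not_connected_def)
  then show ?case
  proof cases
    case 1
    then show ?thesis
      using cong_context[OF IH, of "[v]" "[]"] assms(1) by simp
  next
    case 2
    have swap: "[v, y] \<approx> [v, y, v]"
      by (rule cong_sym) (rule cong_arrow1[OF assms(1) y(1) 2])
    have "v # y # u @ [v] \<approx> [v, y] @ (v # u @ [v])"
      using cong_context[OF swap, of "[]" "u @ [v]"] u assms(1) by simp
    also have "\<dots> \<approx> [v, y] @ (v # u)"
      using cong_context[OF IH, of "[v, y]" "[]"] y(1) assms(1) by simp
    also have "\<dots> \<approx> v # y # u"
      using cong_context[OF cong_sym[OF swap], of "[]" u] u by simp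
    finally show ?thesis by simp
  next
    case 3
    have "v # y # u @ [v] \<approx> [y] @ (v # u @ [v])"
      using cong_context[OF cong_comm[OF 3], of "[]" "u @ [v]"] u assms(1) by simp
    also have "\<dots> \<approx> [y] @ (v # u)"
      using cong_context[OF IH, of "[y]" "[]"] y(1) by simp
    also have "\<dots> \<approx> v # y # u"
      using cong_context[OF cong_sym[OF cong_comm[OF 3]], of "[]" u] u by simp
    finally show ?thesis by simp
  qed
qed

text \<open>Mirror image of \<open>absorb_right\<close>: the final \<open>v\<close> is carried to
  the left, with \<open>[y, v]\<close> \<approx> \<open>[v, y, v]\<close> for an arrow from
  \<open>y\<close> to \<open>v\<close>.\<close>

lemma absorb_left:
  assumes "v \<in> verts G" "set u \<subseteq> verts G" "\<And>y. y \<in> set u \<Longrightarrow> \<not> v \<rightarrow>\<^bsub>G\<^esub> y"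
  shows "v # u @ [v] \<approx> u @ [v]"
  using assms(2,3)
proof (induction u rule: rev_induct)
  case Nil
  then show ?case using assms(1) by (auto intro: cong_idem)
next
  case (snoc y u)
  have y: "y \<in> verts G" "\<not> v \<rightarrow>\<^bsub>G\<^esub> y" and u: "set u \<subseteq> verts G"
    using snoc.prems by auto
  have IH: "v # u @ [v] \<approx> u @ [v]"
    using snoc by auto
  consider "y = v" | "y \<rightarrow>\<^bsub>G\<^esub> v" | "not_connected G y v"
    using y assms(1) by (auto simp: not_connected_def)
  then show ?case
  proof cases
    case 1
    then show ?thesis
      using cong_context[OF IH, of "[]" "[v]"] assms(1) by simp
  next
    case 2
    have swap: "[y, v] \<approx> [v, y, v]"
      by (rule cong_sym) (rule cong_arrow2[OF y(1) assms(1) 2])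
    have "v # u @ [y, v] \<approx> (v # u @ [v]) @ [y, v]"
      using cong_context[OF swap, of "v # u" "[]"] u assms(1) by simp
    also have "\<dots> \<approx> (u @ [v]) @ [y, v]"
      using cong_context[OF IH, of "[]" "[y, v]"] y(1) assms(1) by simp
    also have "\<dots> \<approx> u @ [y, v]"
      using cong_context[OF cong_sym[OF swap], of u "[]"] u by simp
    finally show ?thesis by simp
  next
    case 3
    have "v # u @ [y, v] \<approx> (v # u @ [v]) @ [y]"
      using cong_context[OF cong_comm[OF 3], of "v # u" "[]"] u assms(1) by simp
    also have "\<dots> \<approx> (u @ [v]) @ [y]"
      using cong_context[OF IH, of "[]" "[y]"] y(1) by simp
    also have "\<dots> \<approx> u @ [y, v]"
      using cong_context[OF cong_sym[OF cong_comm[OF 3]], of u "[]"] u by simp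
    finally show ?thesis by simp
  qed
qed

section \<open>Topologically sorted words\<close>

definition topo :: "'a list \<Rightarrow> bool" where
  "topo ts \<longleftrightarrow> set ts \<subseteq> verts G \<and> distinct ts \<and> sorted_wrt (\<lambda>u v. \<not> v \<rightarrow>\<^bsub>G\<^esub> u) ts"

lemma topo_append:
  "topo (ts @ us) \<longleftrightarrow> topo ts \<and> topo us \<and> set ts \<inter> set us = {} \<and>
    (\<forall>u\<in>set ts. \<forall>v\<in>set us. \<not> v \<rightarrow>\<^bsub>G\<^esub> u)"
  by (auto simp: topo_def sorted_wrt_append)

lemma topo_Cons:
  "topo (v # ts) \<longleftrightarrow> v \<in> verts G \<and> v \<notin> set ts \<and> topo ts \<and> (\<forall>u\<in>set ts. \<not> u \<rightarrow>\<^bsub>G\<^esub> v)"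
  by (auto simp: topo_def)

text \<open>No letter behind \<open>v\<close> in a sorted word has an arrow to \<open>v\<close>, so
  \<open>absorb_right\<close> lets the occurrence of \<open>v\<close> in \<open>ts\<close> swallow
  an appended \<open>v\<close>.\<close>

lemma topo_absorb_right:
  assumes "topo ts" "set w \<subseteq> set ts"
  shows "ts @ w \<approx> ts"
  using assms(2)
proof (induction w)
  case Nil
  then show ?case using assms(1) by (auto simp: topo_def intro: cong_refl)
next
  case (Cons v w)
  have w: "set w \<subseteq> verts G"
    using Cons.prems assms(1) by (auto simp: topo_def)
  obtain a b where ts: "ts = a @ v # b"
    using Cons.prems by (auto dest: split_list)
  have "v # b @ [v] \<approx> v # b"
    by (rule absorb_right) (use assms(1) in \<open>auto simp: ts topo_def sorted_wrt_append\<close>)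
  from cong_context[OF this, of a w] have "ts @ v # w \<approx> ts @ w"
    using assms(1) w by (simp add: ts topo_def)
  also have "ts @ w \<approx> ts" using Cons by simp
  finally show ?case .
qed

lemma topo_absorb_left:
  assumes "topo ts" "set w \<subseteq> set ts"
  shows "w @ ts \<approx> ts"
  using assms(2)
proof (induction w rule: rev_induct)
  case Nil
  then show ?case using assms(1) by (auto simp: topo_def intro: cong_refl)
next
  case (snoc v w)
  have w: "set w \<subseteq> verts G"
    using snoc.prems assms(1) by (auto simp: topo_def)
  obtain a b where ts: "ts = a @ v # b"
    using snoc.prems by (auto dest: split_list)
  have "v # a @ [v] \<approx> a @ [v]"
    by (rule absorb_left) (use assms(1) in \<open>auto simp: ts topo_def sorted_wrt_append\<close>)
  from cong_context[OF this, of w b] have "(w @ [v]) @ ts \<approx> w @ ts"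
    using assms(1) w by (simp add: ts topo_def)
  also have "w @ ts \<approx> ts" using snoc by simp
  finally show ?case .
qed

text \<open>A left zero and a right zero coincide: \<open>ts @ us\<close> is congruent to both
  words.\<close>

lemma topo_unique:
  assumes "topo ts" "topo us" "set ts = set us"
  shows "ts \<approx> us"
proof -
  have "ts \<approx> ts @ us"
    by (rule cong_sym) (rule topo_absorb_right, use assms in auto)
  also have "\<dots> \<approx> us"
    by (rule topo_absorb_left) (use assms in auto)
  finally show ?thesis .
qed

text \<open>A \<open>v\<close> that receives no arrow from the letters behind it absorbs every later
  copy of itself; the copies are removed from the right end.\<close>

lemma delete_right:
  assumes "v \<in> verts G" "set u \<subseteq> verts G" "\<And>y. y \<in> set u \<Longrightarrow> \<not> y \<rightarrow>\<^bsub>G\<^esub> v"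
  shows "v # u \<approx> v # filter (\<lambda>y. y \<noteq> v) u"
  using assms(2,3)
proof (induction u rule: rev_induct)
  case Nil
  then show ?case using assms(1) by (auto intro: cong_refl)
next
  case (snoc y u)
  have IH: "v # u \<approx> v # filter (\<lambda>y. y \<noteq> v) u"
    using snoc by auto
  show ?case
  proof (cases "y = v")
    case True
    have "v # u @ [v] \<approx> v # u"
      using snoc.prems assms(1) by (intro absorb_right) auto
    also note IH
    finally show ?thesis using True by simp
  next
    case False
    then show ?thesis
      using cong_context[OF IH, of "[]" "[y]"] snoc.prems by simp
  qed
qed

text \<open>Deleting the source \<open>v\<close> keeps the word idempotent, so that induction applies to the rest; the
  letters in front of \<open>v\<close> are absorbed by the sorted word on the right.\<close>

lemma idempotent_cong_topo:
  assumes "topo ts" "set w = set ts" "w @ w \<approx> w"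
  shows "w \<approx> ts"
  using assms
proof (induction ts arbitrary: w)
  case Nil
  then show ?case by (auto intro: cong_refl)
next
  case (Cons v ts)
  let ?del = "filter (\<lambda>y. y \<noteq> v)"
  have v: "v \<in> verts G" "v \<notin> set ts" "topo ts" and src: "\<And>u. u \<in> set ts \<Longrightarrow> \<not> u \<rightarrow>\<^bsub>G\<^esub> v"
    and V: "set ts \<subseteq> verts G"
    using Cons.prems(1) by (auto simp: topo_Cons topo_def)
  have setw: "set w = insert v (set ts)" using Cons.prems(2) by simp
  have IH: "?del w \<approx> ts"
  proof (rule Cons.IH)
    show "?del w @ ?del w \<approx> ?del w"
      using cong_filter[OF Cons.prems(3), of "\<lambda>y. y \<noteq> v"] by simp
  qed (use v setw in auto)
  obtain a b where w: "w = a @ v # b"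
    using setw by (metis insertI1 split_list)
  have ab: "set a \<subseteq> set (v # ts)" "set b \<subseteq> set (v # ts)"
    using setw w by auto
  have abV: "set a \<subseteq> verts G" "set b \<subseteq> verts G"
    using ab V v(1) by auto
  have "\<not> v \<rightarrow>\<^bsub>G\<^esub> v" using no_two_cycles by blast
  then have src': "\<not> y \<rightarrow>\<^bsub>G\<^esub> v" if "y \<in> set (b @ w)" for y
    using that src ab(2) setw by auto
  \<comment> \<open>Squaring \<open>w\<close> places a full copy of \<open>w\<close> behind a
    \<open>v\<close>. With all later \<open>v\<close> deleted, this copy becomes \<open>ts\<close>
    by the induction hypothesis.\<close>
  have "w \<approx> a @ (v # b @ w)"
    using cong_sym[OF Cons.prems(3)] by (simp add: w)
  also have "\<dots> \<approx> a @ (v # ?del (b @ w))"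
    using cong_context[OF delete_right[OF v(1) _ src'], of "b @ w" a "[]"] abV setw V v(1) by simp
  also have "\<dots> \<approx> (a @ v # ?del b) @ ts"
    using cong_context[OF IH, of "a @ v # ?del b" "[]"] abV v(1) by auto
  also have "\<dots> \<approx> (a @ [v]) @ ts"
    using cong_context[OF topo_absorb_left[OF v(3), of "?del b"], of "a @ [v]" "[]"] ab abV v(1)
    by auto
  also have "\<dots> \<approx> v # ts"
    using topo_absorb_left[OF Cons.prems(1) ab(1)] by simp
  finally show ?case .
qed

section \<open>Update systems\<close>

text \<open>Collina and D'Andrea's update systems: the vertex \<open>v\<close> recomputes its own state from the states
  of its out-neighbours. Words act from the right end.\<close>

definition act :: "('a \<Rightarrow> ('a \<Rightarrow> 'c) \<Rightarrow> 'c) \<Rightarrow> 'a list \<Rightarrow> ('a \<Rightarrow> 'c) \<Rightarrow> 'a \<Rightarrow> 'c" where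
  "act f = foldr (\<lambda>v s. s(v := f v s))"

lemma act_simps [simp]:
  "act f [] s = s"
  "act f (v # w) s = (act f w s)(v := f v (act f w s))"
  "act f (u @ w) s = act f u (act f w s)"
  by (simp_all add: act_def)

text \<open>Since \<open>f v\<close> reads only the out-neighbours of \<open>v\<close>, repeating an
  update changes nothing and unconnected vertices do not influence each other. For an arrow from
  \<open>u\<close> to \<open>v\<close>, the vertex \<open>v\<close> does not read \<open>u\<close>:
  in \<open>[u, v, u]\<close> the last update of \<open>u\<close> overwrites the first, and in
  \<open>[v, u, v]\<close> the second update of \<open>v\<close> recomputes the same state.\<close>

lemma act_cong:
  assumes loc: "\<And>v s s'. (\<And>u. v \<rightarrow>\<^bsub>G\<^esub> u \<Longrightarrow> s u = s' u) \<Longrightarrow> f v s = f v s'"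
    and "v \<approx> w"
  shows "act f v s = act f w s"
  using assms(2) unfolding cong_def
proof (induction arbitrary: s rule: hk_cong.induct)
  case (idem u)
  have "f u (s(u := c)) = f u s" for c
    by (rule loc) (use no_two_cycles in auto)
  then show ?case by simp
next
  case (comm u v)
  have "f u (s(v := c)) = f u s" "f v (s(u := c)) = f v s" for c
    by (rule loc; use comm in \<open>auto simp: not_connected_def\<close>)+
  with comm show ?case by (auto simp: not_connected_def)
next
  case (arrow1 u v)
  then have "u \<noteq> v" "\<not> v \<rightarrow>\<^bsub>G\<^esub> u" using no_two_cycles by blast+
  then have "f v (s(u := c)) = f v s" for c
    by (intro loc) auto
  moreover have "f u (s(u := c, v := d)) = f u (s(v := d))" for c d
    by (rule loc) (use no_two_cycles in auto)
  ultimately show ?case using \<open>u \<noteq> v\<close> by (simp add: fun_upd_twist)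
next
  case (arrow2 u v)
  then have "u \<noteq> v" "\<not> v \<rightarrow>\<^bsub>G\<^esub> u" using no_two_cycles by blast+
  then have "f v (s(v := c, u := d)) = f v s" for c d
    by (intro loc) (use no_two_cycles in auto)
  then show ?case using \<open>u \<noteq> v\<close> by (simp add: fun_eq_iff)
qed simp_all


section \<open>Acyclic sets as contents of idempotents\<close>

text \<open>By finiteness, acyclicity amounts to well-foundedness. The converse relation is taken so
  that minimal elements are sinks.\<close>

lemma acyclic_sets_iff_wf:
  "X \<in> acyclic_sets G \<longleftrightarrow> X \<subseteq> verts G \<and> wf ((arcs_ends G \<inter> X \<times> X)\<inverse>)"
proof -
  interpret H: wf_digraph "induce_subgraph G X" ..
  have ends: "arcs_ends (induce_subgraph G X) = arcs_ends G \<inter> X \<times> X"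
    by (auto simp: arcs_ends_def arc_to_ends_def)
  have "finite (arcs_ends G \<inter> X \<times> X)"
    by (simp add: arcs_ends_def)
  then have "wf ((arcs_ends G \<inter> X \<times> X)\<inverse>) \<longleftrightarrow> acyclic (arcs_ends G \<inter> X \<times> X)"
    by (metis acyclic_converse finite_acyclic_wf_converse wf_acyclic)
  then show ?thesis
    using H.ex_cycle_iff by (auto simp: acyclic_sets_def ends)
qed

lemma acyclic_sets_subset: "X \<in> acyclic_sets G \<Longrightarrow> Y \<subseteq> X \<Longrightarrow> Y \<in> acyclic_sets G"
  unfolding acyclic_sets_iff_wf by (auto elim!: wf_subset)

text \<open>A nonempty set \<open>Q\<close> of letters without sinks would carry an update system in which every update of \<open>v \<in> Q\<close> raises the least
  state on \<open>Q\<close>, so that no state is fixed.\<close>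

lemma idempotent_imp_acyclic:
  assumes "set w \<subseteq> verts G" "w @ w \<approx> w"
  shows "set w \<in> acyclic_sets G"
proof (rule ccontr)
  assume "set w \<notin> acyclic_sets G"
  then have "\<not> wf ((arcs_ends G \<inter> set w \<times> set w)\<inverse>)"
    using assms(1) by (simp add: acyclic_sets_iff_wf)
  then obtain Q c where Q: "c \<in> Q" "\<forall>z\<in>Q. \<exists>y\<in>Q. (z, y) \<in> arcs_ends G \<inter> set w \<times> set w"
    unfolding wf_eq_minimal by fastforce
  then obtain nxt where nxt: "\<And>z. z \<in> Q \<Longrightarrow> nxt z \<in> Q \<and> z \<rightarrow>\<^bsub>G\<^esub> nxt z"
    by (metis IntD1)
  have Qw: "Q \<subseteq> set w" using Q(2) by auto
  \<comment> \<open>\<open>Q\<close> is closed under \<open>nxt\<close>, so the default state 0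
    outside \<open>Q\<close> is never read by a vertex of \<open>Q\<close>.\<close>
  define f where "f v s = (if v \<in> Q then Suc (s (nxt v)) else 0)" for v and s :: "'a \<Rightarrow> nat"
  have loc: "f v s = f v s'" if "\<And>u. v \<rightarrow>\<^bsub>G\<^esub> u \<Longrightarrow> s u = s' u" for v s s'
    using that nxt by (simp add: f_def)
  \<comment> \<open>A lower bound \<open>m\<close> on \<open>Q\<close> survives all updates, and an
    updated vertex exceeds it, being the successor of another state on \<open>Q\<close>. The claim
    is made for all \<open>v\<close> in \<open>Q\<close> at once because \<open>v\<close> reads
    \<open>nxt v\<close>.\<close>
  have grow: "m \<le> act f u s v \<and> (v \<in> set u \<longrightarrow> m < act f u s v)"
    if "\<forall>v\<in>Q. m \<le> s v" "v \<in> Q" for m u s v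
    using that(2)
  proof (induction u arbitrary: v)
    case Nil
    then show ?case using that(1) by simp
  next
    case (Cons y u)
    show ?case
      using Cons.IH[OF Cons.prems] Cons.IH[of "nxt v"] nxt[OF Cons.prems] Cons.prems
      by (auto simp: f_def less_Suc_eq_le)
  qed
  define S where "S = act f w (\<lambda>_. 0)"
  have fixed: "act f w S = S"
    using act_cong[of f, OF loc assms(2)] by (simp add: S_def)
  obtain v where v: "v \<in> Q" "\<forall>y\<in>Q. S v \<le> S y"
    using ex_has_least_nat[of "\<lambda>v. v \<in> Q" c S] Q(1) by blast
  have "S v < act f w S v"
    using grow[OF v(2,1), of w] v(1) Qw by blast
  then show False by (simp add: fixed)
qed

text \<open>A sorted word absorbs itself, hence is idempotent and has acyclic content. Conversely, a
  sink of \<open>X\<close> is put behind a sorted word of the remaining vertices.\<close>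

lemma acyclic_sets_iff_topo: "X \<in> acyclic_sets G \<longleftrightarrow> (\<exists>ts. topo ts \<and> set ts = X)"
proof
  assume "\<exists>ts. topo ts \<and> set ts = X"
  then obtain ts where "topo ts" "set ts = X" by blast
  with topo_absorb_right[of ts ts] show "X \<in> acyclic_sets G"
    using idempotent_imp_acyclic[of ts] by (auto simp: topo_def)
next
  assume X: "X \<in> acyclic_sets G"
  then have "finite X"
    by (auto simp: acyclic_sets_def intro: finite_subset)
  then show "\<exists>ts. topo ts \<and> set ts = X" using X
  proof (induction rule: finite_psubset_induct)
    case (psubset X)
    show ?case
    proof (cases "X = {}")
      case True
      then show ?thesis by (auto simp: topo_def)
    next
      case False
      have wf: "wf ((arcs_ends G \<inter> X \<times> X)\<inverse>)"
        using psubset.prems by (simp add: acyclic_sets_iff_wf)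
      obtain c where c: "c \<in> X" using False by blast
      from wf[unfolded wf_eq_minimal, rule_format, OF c]
      obtain z where z: "z \<in> X" "\<forall>y\<in>X. \<not> z \<rightarrow>\<^bsub>G\<^esub> y" by auto
      have "X - {z} \<in> acyclic_sets G"
        using psubset.prems by (rule acyclic_sets_subset) auto
      then obtain ts where "topo ts" "set ts = X - {z}"
        using psubset.IH[of "X - {z}"] z(1) by blast
      then have "topo (ts @ [z])" "set (ts @ [z]) = X"
        using z psubset.prems by (auto simp: topo_def sorted_wrt_append acyclic_sets_def)
      then show ?thesis by blast
    qed
  qed
qed

text \<open>The choice is immaterial up to congruence, by \<open>topo_unique\<close>.\<close>

definition idem_word :: "'a set \<Rightarrow> 'a list" where
  "idem_word X = (SOME ts. topo ts \<and> set ts = X)"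

lemma idem_word:
  assumes "X \<in> acyclic_sets G"
  shows "topo (idem_word X)" "set (idem_word X) = X"
  using someI_ex[of "\<lambda>ts. topo ts \<and> set ts = X"] assms
  unfolding idem_word_def acyclic_sets_iff_topo by blast+

lemma idem_word_verts: "X \<in> acyclic_sets G \<Longrightarrow> set (idem_word X) \<subseteq> verts G"
  using idem_word by (auto simp: topo_def)

text \<open>This classifies the idempotents: there is exactly one for each acyclic set, represented
  by \<open>idem_word\<close>.\<close>

lemma cong_idem_word_iff:
  assumes "set w \<subseteq> verts G"
  shows "w @ w \<approx> w \<longleftrightarrow> set w \<in> acyclic_sets G \<and> w \<approx> idem_word (set w)"
proof
  assume "w @ w \<approx> w"
  with assms show "set w \<in> acyclic_sets G \<and> w \<approx> idem_word (set w)"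
    using idempotent_imp_acyclic idempotent_cong_topo idem_word by metis
next
  assume *: "set w \<in> acyclic_sets G \<and> w \<approx> idem_word (set w)"
  then have "w @ w \<approx> w @ idem_word (set w)"
    using cong_context[of w "idem_word (set w)" w "[]"] assms by simp
  also have "\<dots> \<approx> idem_word (set w)"
    using * by (intro topo_absorb_left) (auto simp: idem_word)
  also have "\<dots> \<approx> w"
    using * by (blast intro: cong_sym)
  finally show "w @ w \<approx> w" .
qed

section \<open>Products of two idempotents\<close>

text \<open>Let \<open>B\<close> be the part of \<open>X \<inter> Y\<close> reachable from \<open>Y - X\<close> inside \<open>X \<inter> Y\<close>, and \<open>Q = (Y - X) \<union> B\<close>. No
  arrow leads from \<open>Q\<close> to \<open>X \<union> Y - Q\<close>, so that sorted words of the two parts can be concatenated.\<close>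

lemma p_cond_imp_union:
  assumes X: "X \<in> acyclic_sets G" and Y: "Y \<in> acyclic_sets G" and p: "p_cond G X Y"
  shows "X \<union> Y \<in> acyclic_sets G" "idem_word X @ idem_word Y \<approx> idem_word (X \<union> Y)"
proof -
  let ?dom = "\<lambda>u v. u \<rightarrow>\<^bsub>G\<^esub> v"
  define B where "B = {v \<in> X \<inter> Y. \<exists>b\<in>Y - X. \<exists>cs. set cs \<subseteq> X \<inter> Y \<and> successively ?dom (b # cs @ [v])}"
  define Q where "Q = (Y - X) \<union> B"
  define P where "P = X - B"
  have B: "B \<subseteq> X \<inter> Y" by (auto simp: B_def)
  \<comment> \<open>Such an arrow would prolong a chain starting in \<open>Y - X\<close>. Its end
    \<open>r\<close> would then lie in \<open>B\<close> if \<open>r\<close> is in \<open>Y\<close>,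
    and would violate \<open>p_cond\<close> otherwise.\<close>
  have QP: "\<not> q \<rightarrow>\<^bsub>G\<^esub> r" if q: "q \<in> Q" and r: "r \<in> P" for q r
  proof
    assume a: "q \<rightarrow>\<^bsub>G\<^esub> r"
    obtain b cs where b: "b \<in> Y - X" "set cs \<subseteq> X \<inter> Y" "successively ?dom (b # cs @ [r])"
    proof (cases "q \<in> B")
      case True
      then obtain b cs where b: "b \<in> Y - X" "set cs \<subseteq> X \<inter> Y" "successively ?dom (b # cs @ [q])"
        and q': "q \<in> X \<inter> Y"
        by (auto simp: B_def)
      have "successively ?dom ((b # cs @ [q]) @ [r])"
        using b(3) a unfolding successively_append_iff by simp
      with that[of b "cs @ [q]"] b q' show ?thesis by simp
    next
      case False
      with q have "q \<in> Y - X" by (simp add: Q_def)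
      with that[of q "[]"] a show ?thesis by simp
    qed
    show False
    proof (cases "r \<in> Y")
      case True
      with b r show False by (auto simp: P_def B_def)
    next
      case False
      with b r p show False unfolding p_cond_def P_def by blast
    qed
  qed
  let ?P = "idem_word P" and ?Q = "idem_word Q" and ?B = "idem_word B" and ?A = "idem_word (Y - Q)"
  have ac: "P \<in> acyclic_sets G" "B \<in> acyclic_sets G" "Q \<in> acyclic_sets G" "Y - Q \<in> acyclic_sets G"
    using acyclic_sets_subset[OF X, of P] acyclic_sets_subset[OF X, of B]
      acyclic_sets_subset[OF Y, of Q] acyclic_sets_subset[OF Y, of "Y - Q"] B
    by (auto simp: P_def Q_def)
  note t = ac[THEN idem_word(1)] and st [simp] = ac[THEN idem_word(2)]
  have V: "P \<subseteq> verts G" "B \<subseteq> verts G" "Q \<subseteq> verts G" "Y - Q \<subseteq> verts G" "X \<subseteq> verts G" "Y \<subseteq> verts G"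
    using ac X Y by (auto simp: acyclic_sets_def)
  note X' [simp] = idem_word(2)[OF X] and Y' [simp] = idem_word(2)[OF Y]
  have disj: "P \<inter> Q = {}" "P \<inter> B = {}" "B \<subseteq> Q" "Y - Q \<subseteq> P"
    and cover: "P \<union> B = X" "P \<union> Q = X \<union> Y" "Y \<union> Q = Y" "Y - Q \<subseteq> X"
    using B by (auto simp: P_def Q_def)
  have PQ: "topo (?P @ ?Q)"
    using t disj QP by (auto simp: topo_append dest: subsetD)
  have un: "set (?P @ ?Q) = X \<union> Y"
    using cover by simp
  show ac': "X \<union> Y \<in> acyclic_sets G"
    unfolding acyclic_sets_iff_topo using PQ un by blast
  have PB: "topo (?P @ ?B)"
    using t disj QP by (auto simp: topo_append dest: subsetD)
  have AQ: "topo (?A @ ?Q)"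
    using t disj QP by (auto simp: topo_append dest: subsetD)
  \<comment> \<open>The word of \<open>Y\<close> is split as \<open>?A @ ?Q\<close> and that of
    \<open>X\<close> as \<open>?P @ ?B\<close>. Then \<open>?A\<close> is absorbed by the word of
    \<open>X\<close>, and \<open>?B\<close> by \<open>?Q\<close>.\<close>
  have "idem_word X @ idem_word Y \<approx> idem_word X @ (?A @ ?Q)"
    using cong_context[OF topo_unique[OF idem_word(1)[OF Y] AQ], of "idem_word X" "[]"] V cover
    by simp
  also have "\<dots> \<approx> idem_word X @ ?Q"
    using cong_context[OF topo_absorb_right[OF idem_word(1)[OF X], of ?A], of "[]" ?Q] V cover
    by simp
  also have "\<dots> \<approx> (?P @ ?B) @ ?Q"
    using cong_context[OF topo_unique[OF idem_word(1)[OF X] PB], of "[]" ?Q] V cover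
    by simp
  also have "\<dots> \<approx> ?P @ ?Q"
    using cong_context[OF topo_absorb_left[OF t(3), of ?B], of ?P "[]"] V disj
    by simp
  also have "\<dots> \<approx> idem_word (X \<union> Y)"
    by (rule topo_unique) (use PQ cover idem_word[OF ac'] in auto)
  finally show "idem_word X @ idem_word Y \<approx> idem_word (X \<union> Y)" .
qed

text \<open>If a chain from \<open>b\<close> to \<open>a\<close> violates \<open>p_cond\<close>, then the update system for reachability of \<open>a\<close>,
  started in the empty state, marks \<open>b\<close> under the word of \<open>X \<union> Y\<close>, but not under the word of \<open>Y\<close>
  followed by that of \<open>X\<close>.\<close>

lemma idempotent_imp_p_cond:
  assumes X: "X \<in> acyclic_sets G" and Y: "Y \<in> acyclic_sets G"
    and idem: "(idem_word X @ idem_word Y) @ (idem_word X @ idem_word Y) \<approx> idem_word X @ idem_word Y"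
  shows "p_cond G X Y"
  unfolding p_cond_def
proof (safe)
  fix a b cs
  assume b: "b \<in> Y" "b \<notin> X" and a: "a \<in> X" "a \<notin> Y" and cs: "set cs \<subseteq> X \<inter> Y"
    and chain: "successively (\<lambda>u v. u \<rightarrow>\<^bsub>G\<^esub> v) (b # cs @ [a])"
  let ?w = "idem_word X @ idem_word Y"
  note st = idem_word(2)[OF X] idem_word(2)[OF Y]
  have w: "set ?w \<subseteq> verts G" using idem_word_verts X Y by simp
  define f where "f v s = (v = a \<or> (\<exists>u. v \<rightarrow>\<^bsub>G\<^esub> u \<and> s u))" for v and s :: "'a \<Rightarrow> bool"
  have loc: "f v s = f v s'" if "\<And>u. v \<rightarrow>\<^bsub>G\<^esub> u \<Longrightarrow> s u = s' u" for v s s'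
    using that by (auto simp: f_def)
  define S where "S = act f ?w (\<lambda>_. False)"
  \<comment> \<open>Idempotency makes \<open>?w\<close> a zero for the letters of its content, so
    prefixing such a letter \<open>v\<close> changes neither the class of \<open>?w\<close> nor the
    state \<open>S\<close>.\<close>
  have fixed: "f v S = S v" if v: "v \<in> X \<union> Y" for v
  proof -
    have w': "set ?w \<in> acyclic_sets G" "?w \<approx> idem_word (set ?w)"
      using cong_idem_word_iff[OF w] idem by auto
    have vV: "v \<in> verts G" using v X Y by (auto simp: acyclic_sets_def)
    have "[v] @ ?w \<approx> [v] @ idem_word (set ?w)"
      using cong_context[OF w'(2), of "[v]" "[]"] vV by simp
    also have "\<dots> \<approx> idem_word (set ?w)"
      by (rule topo_absorb_left) (use w' v st in \<open>auto simp: idem_word\<close>)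
    also have "\<dots> \<approx> ?w" using w'(2) by (rule cong_sym)
    finally have absorb: "[v] @ ?w \<approx> ?w" .
    have "act f ([v] @ ?w) (\<lambda>_. False) = S"
      unfolding S_def using act_cong[of f, OF loc absorb] by blast
    then have "S(v := f v S) = S" by (simp add: S_def)
    then show ?thesis by (metis fun_upd_same)
  qed
  \<comment> \<open>Marks spread backwards along the chain from \<open>a\<close>; the start
    \<open>b'\<close> is generalised for the induction over the inner vertices.\<close>
  have "S b'" if "b' \<in> X \<union> Y" "successively (\<lambda>u v. u \<rightarrow>\<^bsub>G\<^esub> v) (b' # cs @ [a])" for b'
    using that cs
  proof (induction cs arbitrary: b')
    case Nil
    have "S a" using fixed[of a] a by (simp add: f_def)
    with Nil fixed[of b'] show ?case by (auto simp: f_def)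
  next
    case (Cons c cs)
    then have "S c" by simp
    with Cons fixed[of b'] show ?case by (auto simp: f_def)
  qed
  then have "S b" using b chain by blast
  \<comment> \<open>The word of \<open>Y\<close> acts first and lacks \<open>a\<close>, so nothing
    gets marked; the word of \<open>X\<close> lacks \<open>b\<close> and cannot mark it
    afterwards.\<close>
  moreover have "act f u (\<lambda>_. False) = (\<lambda>_. False)" if "a \<notin> set u" for u
    using that by (induction u) (auto simp: f_def)
  moreover have "act f u s b = s b" if "b \<notin> set u" for u s
    using that by (induction u) auto
  ultimately show False
    using a b by (simp add: S_def st)
qed

section \<open>Substitutions and admissible families\<close>

text \<open>The universal property of the presentation, stated for words: it suffices that the
  images of the letters satisfy the defining relations.\<close>

lemma concat_map_cong:
  assumes verts: "\<And>v. v \<in> verts G \<Longrightarrow> set (\<sigma> v) \<subseteq> verts G"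
    and idem: "\<And>v. v \<in> verts G \<Longrightarrow> \<sigma> v @ \<sigma> v \<approx> \<sigma> v"
    and comm: "\<And>u v. not_connected G u v \<Longrightarrow> \<sigma> u @ \<sigma> v \<approx> \<sigma> v @ \<sigma> u"
    and arrow1: "\<And>u v. u \<rightarrow>\<^bsub>G\<^esub> v \<Longrightarrow> \<sigma> u @ \<sigma> v @ \<sigma> u \<approx> \<sigma> u @ \<sigma> v"
    and arrow2: "\<And>u v. u \<rightarrow>\<^bsub>G\<^esub> v \<Longrightarrow> \<sigma> v @ \<sigma> u @ \<sigma> v \<approx> \<sigma> u @ \<sigma> v"
    and "v \<approx> w"
  shows "concat (map \<sigma> v) \<approx> concat (map \<sigma> w)"
  using assms(6) unfolding cong_def
proof (induction rule: hk_cong.induct)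
  case (refl w)
  then show ?case using verts by (intro hk_cong.refl) fastforce
next
  case (sym v w)
  show ?case using sym.IH by (rule hk_cong.sym)
next
  case (trans u v w)
  show ?case by (rule hk_cong.trans[OF trans.IH])
next
  case (mult v w a b)
  have "set (concat (map \<sigma> a)) \<subseteq> verts G" "set (concat (map \<sigma> b)) \<subseteq> verts G"
    using mult.hyps verts by fastforce+
  then show ?case
    using cong_context[OF mult.IH[folded cong_def]] by (simp add: cong_def)
qed (use assms in \<open>simp_all add: cong_def\<close>)

text \<open>Admissibility indexed by vertices; the translation to lists is postponed to the final
  theorem.\<close>

definition adm :: "('a \<Rightarrow> 'a set) \<Rightarrow> bool" where
  "adm X \<longleftrightarrow> (\<forall>v\<in>verts G. X v \<in> acyclic_sets G) \<and>
     (\<forall>u v. not_connected G u v \<longrightarrow> p_cond G (X u) (X v) \<and> p_cond G (X v) (X u)) \<and>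
     (\<forall>u v. u \<rightarrow>\<^bsub>G\<^esub> v \<longrightarrow> p_cond G (X u) (X v))"

text \<open>By \<open>p_cond_imp_union\<close>, the product for \<open>u\<close> and
  \<open>v\<close> is the idempotent of \<open>X u \<union> X v\<close>. For unconnected vertices
  this holds in both orders; for an arrow, this idempotent absorbs both factors on either
  side.\<close>

lemma concat_map_idem_word_cong:
  assumes X: "adm X" and "v \<approx> w"
  shows "concat (map (\<lambda>v. idem_word (X v)) v) \<approx> concat (map (\<lambda>v. idem_word (X v)) w)"
proof (rule concat_map_cong[OF _ _ _ _ _ assms(2)])
  let ?\<sigma> = "\<lambda>v. idem_word (X v)"
  have ac: "X v \<in> acyclic_sets G" if "v \<in> verts G" for v
    using X that by (simp add: adm_def)
  show verts: "set (?\<sigma> v) \<subseteq> verts G" if "v \<in> verts G" for v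
    using idem_word_verts ac that by blast
  show "?\<sigma> v @ ?\<sigma> v \<approx> ?\<sigma> v" if "v \<in> verts G" for v
    by (rule topo_absorb_right) (use ac that idem_word in auto)
  show "?\<sigma> u @ ?\<sigma> v \<approx> ?\<sigma> v @ ?\<sigma> u" if uv: "not_connected G u v" for u v
  proof -
    have V: "u \<in> verts G" "v \<in> verts G" using uv by (auto simp: not_connected_def)
    have p: "p_cond G (X u) (X v)" "p_cond G (X v) (X u)" using X uv by (auto simp: adm_def)
    have "?\<sigma> u @ ?\<sigma> v \<approx> idem_word (X u \<union> X v)"
      using p_cond_imp_union(2) ac V p by blast
    also have "\<dots> \<approx> ?\<sigma> v @ ?\<sigma> u"
      using p_cond_imp_union(2) ac V p by (metis Un_commute cong_sym)
    finally show ?thesis .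
  qed
  fix u v assume uv: "u \<rightarrow>\<^bsub>G\<^esub> v"
  have V: "u \<in> verts G" "v \<in> verts G" using uv by (auto dest: adj_in_verts)
  have p: "p_cond G (X u) (X v)" using X uv by (auto simp: adm_def)
  note un = p_cond_imp_union[OF ac[OF V(1)] ac[OF V(2)] p]
  note t = idem_word[OF un(1)] and st = idem_word(2)[OF ac[OF V(1)]] idem_word(2)[OF ac[OF V(2)]]
  have "?\<sigma> u @ ?\<sigma> v @ ?\<sigma> u \<approx> idem_word (X u \<union> X v) @ ?\<sigma> u"
    using cong_context[OF un(2), of "[]" "?\<sigma> u"] verts V by simp
  also have "\<dots> \<approx> idem_word (X u \<union> X v)"
    by (rule topo_absorb_right) (use t st in auto)
  also note cong_sym[OF un(2)]
  finally show "?\<sigma> u @ ?\<sigma> v @ ?\<sigma> u \<approx> ?\<sigma> u @ ?\<sigma> v" .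
  have "?\<sigma> v @ ?\<sigma> u @ ?\<sigma> v \<approx> ?\<sigma> v @ idem_word (X u \<union> X v)"
    using cong_context[OF un(2), of "?\<sigma> v" "[]"] verts V by simp
  also have "\<dots> \<approx> idem_word (X u \<union> X v)"
    by (rule topo_absorb_left) (use t st in auto)
  also note cong_sym[OF un(2)]
  finally show "?\<sigma> v @ ?\<sigma> u @ ?\<sigma> v \<approx> ?\<sigma> u @ ?\<sigma> v" .
qed

section \<open>Endomorphisms and the contents of generator images\<close>

definition gen_content :: "('a list set \<Rightarrow> 'a list set) \<Rightarrow> 'a \<Rightarrow> 'a set" where
  "gen_content \<phi> v = content (\<phi> (hk_gen G v))"

lemma hk_class_in_carrier: "set w \<subseteq> verts G \<Longrightarrow> hk_class G w \<in> carrier (HK G)"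
  by (auto simp: carrier_HK)

lemma hk_class_mult:
  "set v \<subseteq> verts G \<Longrightarrow> set w \<subseteq> verts G \<Longrightarrow>
    hk_class G v \<otimes>\<^bsub>HK G\<^esub> hk_class G w = hk_class G (v @ w)"
  by (rule mult_hk_class) auto

lemma content_eq_set: "set w \<subseteq> verts G \<Longrightarrow> content (hk_class G w) = set w"
  by (rule content_hk_class) auto

text \<open>Choosing a word for the image of each generator lifts \<phi> to words. Preservation of
  the identity is what settles the empty word.\<close>

lemma End_as_substitution:
  assumes "\<phi> \<in> carrier (End_monoid (HK G))"
  obtains \<sigma> where "\<And>v. v \<in> verts G \<Longrightarrow> set (\<sigma> v) \<subseteq> verts G"
    and "\<And>w. set w \<subseteq> verts G \<Longrightarrow> \<phi> (hk_class G w) = hk_class G (concat (map \<sigma> w))"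
proof -
  have hom: "\<phi> \<in> hom (HK G) (HK G)" and one: "\<phi> (hk_class G []) = hk_class G []"
    using assms by (auto simp: End_monoid_def one_HK)
  have "\<exists>w. set w \<subseteq> verts G \<and> \<phi> (hk_class G [v]) = hk_class G w" if "v \<in> verts G" for v
  proof -
    have "\<phi> (hk_class G [v]) \<in> carrier (HK G)"
      using hom_in_carrier[OF hom] hk_class_in_carrier[of "[v]"] that by simp
    then show ?thesis by (auto simp: carrier_HK)
  qed
  then obtain \<sigma> where \<sigma>: "\<And>v. v \<in> verts G \<Longrightarrow> set (\<sigma> v) \<subseteq> verts G"
    "\<And>v. v \<in> verts G \<Longrightarrow> \<phi> (hk_class G [v]) = hk_class G (\<sigma> v)"
    by metis
  have "\<phi> (hk_class G w) = hk_class G (concat (map \<sigma> w))" if "set w \<subseteq> verts G" for w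
    using that
  proof (induction w)
    case Nil
    then show ?case using one by simp
  next
    case (Cons v w)
    have sw: "set (concat (map \<sigma> w)) \<subseteq> verts G"
      using Cons.prems \<sigma>(1) by fastforce
    have "\<phi> (hk_class G (v # w)) = \<phi> (hk_class G [v] \<otimes>\<^bsub>HK G\<^esub> hk_class G w)"
      using Cons.prems by (simp add: hk_class_mult)
    also have "\<dots> = hk_class G (\<sigma> v) \<otimes>\<^bsub>HK G\<^esub> hk_class G (concat (map \<sigma> w))"
      using Cons hom_mult[OF hom] \<sigma>(2) by (simp add: hk_class_in_carrier)
    also have "\<dots> = hk_class G (concat (map \<sigma> (v # w)))"
      using Cons.prems \<sigma>(1) sw by (simp add: hk_class_mult)
    finally show ?case .
  qed
  with \<sigma>(1) that show thesis by blast
qed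

text \<open>Generators are idempotent, so their images are the idempotents of their contents; hence
  these contents determine \<phi>.\<close>

lemma End_gen_content:
  assumes \<phi>: "\<phi> \<in> carrier (End_monoid (HK G))"
  shows "adm (gen_content \<phi>)"
    and "set w \<subseteq> verts G \<Longrightarrow>
      \<phi> (hk_class G w) = hk_class G (concat (map (\<lambda>v. idem_word (gen_content \<phi> v)) w))"
proof -
  obtain \<sigma> where \<sigma>: "\<And>v. v \<in> verts G \<Longrightarrow> set (\<sigma> v) \<subseteq> verts G"
    and rep: "\<And>w. set w \<subseteq> verts G \<Longrightarrow> \<phi> (hk_class G w) = hk_class G (concat (map \<sigma> w))"
    using End_as_substitution[OF \<phi>] by blast
  let ?\<tau> = "\<lambda>v. idem_word (gen_content \<phi> v)"
  have cong_\<sigma>: "concat (map \<sigma> v) \<approx> concat (map \<sigma> w)"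
    if vw: "v \<approx> w" "set v \<subseteq> verts G" for v w
  proof -
    have "set w \<subseteq> verts G" using cong_set vw by blast
    moreover from this have "hk_class G v = hk_class G w"
      using vw by (simp add: hk_class_eq_iff)
    moreover have "set (concat (map \<sigma> u)) \<subseteq> verts G" if "set u \<subseteq> verts G" for u
      using that \<sigma> by fastforce
    ultimately show ?thesis
      using rep vw(2) by (metis hk_class_eq_iff)
  qed
  have set\<sigma>: "set (\<sigma> v) = gen_content \<phi> v" if "v \<in> verts G" for v
    using rep[of "[v]"] \<sigma>[OF that] that by (auto simp: gen_content_def hk_gen_def content_eq_set)
  have "\<sigma> v @ \<sigma> v \<approx> \<sigma> v" if "v \<in> verts G" for v
    using cong_\<sigma>[OF cong_idem[OF that]] that by simp
  then have ac: "gen_content \<phi> v \<in> acyclic_sets G" and \<sigma>\<tau>: "\<sigma> v \<approx> ?\<tau> v" if "v \<in> verts G" for v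
    using that cong_idem_word_iff[OF \<sigma>] set\<sigma> by auto
  have \<tau>: "set (?\<tau> v) \<subseteq> verts G" if "v \<in> verts G" for v
    using idem_word_verts ac that by blast
  have cong_\<sigma>\<tau>: "concat (map \<sigma> w) \<approx> concat (map ?\<tau> w)" if "set w \<subseteq> verts G" for w
    using that
  proof (induction w)
    case Nil
    then show ?case by (simp add: cong_refl)
  next
    case (Cons v w)
    have "set (concat (map \<sigma> w)) \<subseteq> verts G"
      using Cons.prems \<sigma> by fastforce
    then have "concat (map \<sigma> (v # w)) \<approx> ?\<tau> v @ concat (map \<sigma> w)"
      using cong_context[OF \<sigma>\<tau>, of v "[]" "concat (map \<sigma> w)"] Cons.prems by simp
    also have "\<dots> \<approx> ?\<tau> v @ concat (map ?\<tau> w)"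
      using cong_context[OF Cons.IH, of "?\<tau> v" "[]"] Cons.prems \<tau> by simp
    finally show ?case by simp
  qed
  show "\<phi> (hk_class G w) = hk_class G (concat (map ?\<tau> w))" if "set w \<subseteq> verts G" for w
  proof -
    have "set (concat (map \<sigma> w)) \<subseteq> verts G" using that \<sigma> by fastforce
    with cong_\<sigma>\<tau>[OF that] cong_set show ?thesis
      unfolding rep[OF that] by (metis hk_class_eq_iff)
  qed
  \<comment> \<open>Without an arrow from \<open>v\<close> to \<open>u\<close> the word
    \<open>[u, v]\<close> is sorted, hence idempotent, and so is its image. This covers arrows from
    \<open>u\<close> to \<open>v\<close> as well as unconnected vertices in both orders.\<close>
  have p: "p_cond G (gen_content \<phi> u) (gen_content \<phi> v)"
    if V: "u \<in> verts G" "v \<in> verts G" "u \<noteq> v" "\<not> v \<rightarrow>\<^bsub>G\<^esub> u" for u v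
  proof (rule idempotent_imp_p_cond)
    have "topo [u, v]"
      using V by (simp add: topo_def)
    then have uv: "[u, v] @ [u, v] \<approx> [u, v]"
      by (rule topo_absorb_right) simp
    have "concat (map ?\<tau> ([u, v] @ [u, v])) \<approx> concat (map \<sigma> ([u, v] @ [u, v]))"
      by (rule cong_sym[OF cong_\<sigma>\<tau>]) (use V in simp)
    also have "\<dots> \<approx> concat (map \<sigma> [u, v])"
      by (rule cong_\<sigma>[OF uv]) (use V in simp)
    also have "\<dots> \<approx> concat (map ?\<tau> [u, v])"
      by (rule cong_\<sigma>\<tau>) (use V in simp)
    finally show "(?\<tau> u @ ?\<tau> v) @ (?\<tau> u @ ?\<tau> v) \<approx> ?\<tau> u @ ?\<tau> v" by simp
  qed (use ac V in auto)
  show "adm (gen_content \<phi>)"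
    unfolding adm_def
  proof (intro conjI ballI allI impI)
    fix u v assume "u \<rightarrow>\<^bsub>G\<^esub> v"
    moreover from this have "u \<in> verts G" "v \<in> verts G" by (auto dest: adj_in_verts)
    ultimately show "p_cond G (gen_content \<phi> u) (gen_content \<phi> v)"
      using no_two_cycles by (intro p) auto
  qed (use ac p in \<open>auto simp: not_connected_def\<close>)
qed

lemma adm_imp_End:
  assumes X: "adm X"
  obtains \<phi> where "\<phi> \<in> carrier (End_monoid (HK G))"
    and "\<And>v. v \<in> verts G \<Longrightarrow> gen_content \<phi> v = X v"
proof -
  let ?\<sigma> = "\<lambda>v. idem_word (X v)"
  \<comment> \<open>An element is a set of words, so a representative is chosen; the value does not
    depend on it because the substitution respects the congruence.\<close>
  define \<phi> where "\<phi> = (\<lambda>P\<in>carrier (HK G). hk_class G (concat (map ?\<sigma> (SOME w. w \<in> P))))"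
  have ac: "X v \<in> acyclic_sets G" if "v \<in> verts G" for v
    using X that by (simp add: adm_def)
  have V: "set (concat (map ?\<sigma> w)) \<subseteq> verts G" if "set w \<subseteq> verts G" for w
    using idem_word_verts ac that by fastforce
  have rep: "\<phi> (hk_class G w) = hk_class G (concat (map ?\<sigma> w))" if w: "set w \<subseteq> verts G" for w
  proof -
    define w' where "w' = (SOME w'. w' \<in> hk_class G w)"
    have "w \<in> hk_class G w" using w by (intro hk_class_self) auto
    then have "w' \<in> hk_class G w" unfolding w'_def by (rule someI)
    then have "w \<approx> w'" by (simp add: hk_class_def cong_def)
    moreover from this have "set w' \<subseteq> verts G" using w cong_set by blast
    ultimately have "hk_class G (concat (map ?\<sigma> w')) = hk_class G (concat (map ?\<sigma> w))"
      using concat_map_idem_word_cong[OF X] cong_sym V w by (simp add: hk_class_eq_iff)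
    then show ?thesis
      using hk_class_in_carrier[OF w] by (simp add: \<phi>_def w'_def)
  qed
  show thesis
  proof
    have "\<phi> \<in> hom (HK G) (HK G)"
    proof (rule homI)
      fix P assume "P \<in> carrier (HK G)"
      then obtain w where "P = hk_class G w" "set w \<subseteq> verts G" by (auto simp: carrier_HK)
      then show "\<phi> P \<in> carrier (HK G)"
        using rep V hk_class_in_carrier by simp
    next
      fix P Q assume "P \<in> carrier (HK G)" "Q \<in> carrier (HK G)"
      then obtain v w where "P = hk_class G v" "set v \<subseteq> verts G" "Q = hk_class G w" "set w \<subseteq> verts G"
        by (auto simp: carrier_HK)
      then show "\<phi> (P \<otimes>\<^bsub>HK G\<^esub> Q) = \<phi> P \<otimes>\<^bsub>HK G\<^esub> \<phi> Q"
        using V[of v] V[of w] by (simp add: hk_class_mult rep)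
    qed
    then show "\<phi> \<in> carrier (End_monoid (HK G))"
      using rep[of "[]"] by (simp add: End_monoid_def one_HK) (simp add: \<phi>_def)
    show "gen_content \<phi> v = X v" if "v \<in> verts G" for v
      using rep[of "[v]"] V[of "[v]"] that ac idem_word(2)
      by (simp add: gen_content_def hk_gen_def content_eq_set subset_iff)
  qed
qed

lemma End_eqI:
  assumes \<phi>: "\<phi> \<in> carrier (End_monoid (HK G))" and \<psi>: "\<psi> \<in> carrier (End_monoid (HK G))"
    and eq: "\<And>v. v \<in> verts G \<Longrightarrow> gen_content \<phi> v = gen_content \<psi> v"
  shows "\<phi> = \<psi>"
proof (rule extensionalityI)
  show "\<phi> \<in> extensional (carrier (HK G))" "\<psi> \<in> extensional (carrier (HK G))"
    using \<phi> \<psi> by (simp_all add: End_monoid_def)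
  fix P assume "P \<in> carrier (HK G)"
  then obtain w where w: "P = hk_class G w" "set w \<subseteq> verts G" by (auto simp: carrier_HK)
  then have eq': "map (\<lambda>v. idem_word (gen_content \<phi> v)) w = map (\<lambda>v. idem_word (gen_content \<psi> v)) w"
    using eq by auto
  show "\<phi> P = \<psi> P"
    by (simp only: w(1) End_gen_content(2)[OF \<phi> w(2)] End_gen_content(2)[OF \<psi> w(2)] eq')
qed

text \<open>Substituting words for the letters of a word unites their contents; read entrywise, this
  union is the Boolean matrix product.\<close>

lemma gen_content_mult:
  assumes \<psi>: "\<psi> \<in> carrier (End_monoid (HK G))" and \<phi>: "\<phi> \<in> carrier (End_monoid (HK G))"
    and v: "v \<in> verts G"
  shows "gen_content (\<psi> \<otimes>\<^bsub>End_monoid (HK G)\<^esub> \<phi>) v = (\<Union>u\<in>gen_content \<phi> v. gen_content \<psi> u)"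
proof -
  have ac: "gen_content \<phi> v \<in> acyclic_sets G"
    using End_gen_content(1)[OF \<phi>] v by (simp add: adm_def)
  have ac': "gen_content \<psi> u \<in> acyclic_sets G" if "u \<in> verts G" for u
    using End_gen_content(1)[OF \<psi>] that by (simp add: adm_def)
  let ?w = "idem_word (gen_content \<phi> v)"
  let ?u = "concat (map (\<lambda>v. idem_word (gen_content \<psi> v)) ?w)"
  have w: "set ?w \<subseteq> verts G" using idem_word_verts[OF ac] .
  have "\<phi> (hk_class G [v]) = hk_class G ?w"
    using End_gen_content(2)[OF \<phi>, of "[v]"] v by simp
  then have "(\<psi> \<otimes>\<^bsub>End_monoid (HK G)\<^esub> \<phi>) (hk_gen G v) = \<psi> (hk_class G ?w)"
    using hk_class_in_carrier[of "[v]"] v by (simp add: End_monoid_def compose_def hk_gen_def)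
  also have "\<dots> = hk_class G ?u"
    by (rule End_gen_content(2)[OF \<psi> w])
  finally have "gen_content (\<psi> \<otimes>\<^bsub>End_monoid (HK G)\<^esub> \<phi>) v = content (hk_class G ?u)"
    by (simp add: gen_content_def)
  also have "\<dots> = set ?u"
    by (rule content_eq_set) (use w idem_word_verts[OF ac'] in fastforce)
  also have "\<dots> = (\<Union>u\<in>set ?w. set (idem_word (gen_content \<psi> u)))"
    by simp
  also have "\<dots> = (\<Union>u\<in>set ?w. gen_content \<psi> u)"
    using w idem_word(2)[OF ac'] by (intro SUP_cong) auto
  finally show ?thesis by (simp add: idem_word(2)[OF ac])
qed

lemma gen_content_one: "v \<in> verts G \<Longrightarrow> gen_content \<one>\<^bsub>End_monoid (HK G)\<^esub> v = {v}"
  using hk_class_in_carrier[of "[v]"]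
  by (simp add: gen_content_def End_monoid_def hk_gen_def content_eq_set)

end

section \<open>Transfer to Boolean matrices\<close>

text \<open>The monoid laws pass to the image of a multiplicative map. This yields closure of the
  set of matrices under the product without a direct argument on admissible sequences.\<close>

lemma (in monoid) surj_hom_imp_monoid:
  assumes h: "h \<in> hom G H" and surj: "h ` carrier G = carrier H" and one: "h \<one> = \<one>\<^bsub>H\<^esub>"
  shows "monoid H"
  by (rule monoidI, unfold surj[symmetric] one[symmetric])
    (auto simp flip: hom_mult[OF h] simp: m_assoc)

theorem theorem5p4:
  fixes \<Theta> :: "('a, 'b) pre_digraph"
    and x :: "nat \<Rightarrow> 'a"
    and n :: nat
  assumes "oriented_graph \<Theta>"
    and "n \<ge> 1"
    and "bij_betw x {..<n} (verts \<Theta>)"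
  shows "monoid (bool_mat_monoid n (Psi x n ` admissible \<Theta> x n)) \<and>
    Psi x n \<circ> Phi \<Theta> x n
      \<in> iso (End_monoid (HK \<Theta>)) (bool_mat_monoid n (Psi x n ` admissible \<Theta> x n)) \<and>
    (Psi x n \<circ> Phi \<Theta> x n) \<one>\<^bsub>End_monoid (HK \<Theta>)\<^esub>
      = \<one>\<^bsub>bool_mat_monoid n (Psi x n ` admissible \<Theta> x n)\<^esub>"
proof -
  interpret oriented_graph \<Theta> by (rule assms(1))
  let ?E = "End_monoid (HK \<Theta>)"
  let ?M = "bool_mat_monoid n (Psi x n ` admissible \<Theta> x n)"
  let ?h = "Psi x n \<circ> Phi \<Theta> x n"
  interpret E: monoid ?E by (rule monoid_End_monoid[OF monoid_HK])
  have xV: "x i \<in> verts \<Theta>" if "i < n" for i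
    using assms(3) that by (auto simp: bij_betw_def)
  have x_eq: "x i = x j \<longleftrightarrow> i = j" if "i < n" "j < n" for i j
    using assms(3) that by (auto simp: bij_betw_def inj_on_def)
  have verts: "verts \<Theta> = x ` {..<n}"
    using assms(3) by (auto simp: bij_betw_def)
  have Phi: "Phi \<Theta> x n \<phi> = map (\<lambda>i. gen_content \<phi> (x i)) [0..<n]" for \<phi>
    by (simp add: Phi_def gen_content_def)
  have h: "?h \<phi> = mat n n (\<lambda>(i, j). x i \<in> gen_content \<phi> (x j))" for \<phi>
    by (auto simp: Psi_def Phi)
  have sub: "gen_content \<phi> v \<subseteq> verts \<Theta>" if "\<phi> \<in> carrier ?E" "v \<in> verts \<Theta>" for \<phi> v
    using End_gen_content(1)[OF that(1)] that(2) by (auto simp: adm_def acyclic_sets_def)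
  have "Phi \<Theta> x n ` carrier ?E = admissible \<Theta> x n"
  proof (intro equalityI subsetI)
    fix Xs assume "Xs \<in> Phi \<Theta> x n ` carrier ?E"
    then obtain \<phi> where \<phi>: "\<phi> \<in> carrier ?E" "Xs = Phi \<Theta> x n \<phi>" by blast
    then show "Xs \<in> admissible \<Theta> x n"
      using End_gen_content(1)[OF \<phi>(1)] xV by (auto simp: admissible_def adm_def Phi)
  next
    fix Xs assume Xs: "Xs \<in> admissible \<Theta> x n"
    \<comment> \<open>The list is reindexed by vertices through the inverse of the enumeration
      \<open>x\<close>.\<close>
    define X where "X v = Xs ! the_inv_into {..<n} x v" for v
    have X: "X (x i) = Xs ! i" if "i < n" for i
      using that assms(3) by (simp add: X_def bij_betw_def the_inv_into_f_f)
    have ex: "\<exists>i<n. v = x i" if "v \<in> verts \<Theta>" for v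
      using that verts by auto
    have "adm X"
      unfolding adm_def
    proof (intro conjI ballI allI impI)
      fix v assume "v \<in> verts \<Theta>"
      then show "X v \<in> acyclic_sets \<Theta>"
        using ex X Xs by (fastforce simp: admissible_def)
    next
      fix u v assume uv: "not_connected \<Theta> u v"
      then have "u \<in> verts \<Theta>" "v \<in> verts \<Theta>" by (auto simp: not_connected_def)
      with ex obtain i j where "i < n" "j < n" "u = x i" "v = x j" by metis
      with uv X Xs show "p_cond \<Theta> (X u) (X v)" "p_cond \<Theta> (X v) (X u)"
        by (auto simp: admissible_def)
    next
      fix u v assume uv: "u \<rightarrow>\<^bsub>\<Theta>\<^esub> v"
      then have "u \<in> verts \<Theta>" "v \<in> verts \<Theta>" by (auto dest: adj_in_verts)
      with ex obtain i j where "i < n" "j < n" "u = x i" "v = x j" by metis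
      with uv X Xs show "p_cond \<Theta> (X u) (X v)"
        by (auto simp: admissible_def)
    qed
    then obtain \<phi> where \<phi>: "\<phi> \<in> carrier ?E" "\<And>v. v \<in> verts \<Theta> \<Longrightarrow> gen_content \<phi> v = X v"
      using adm_imp_End by blast
    have "Phi \<Theta> x n \<phi> = Xs"
      using Xs xV X \<phi>(2) by (auto simp: Phi admissible_def intro: nth_equalityI)
    with \<phi>(1) show "Xs \<in> Phi \<Theta> x n ` carrier ?E" by blast
  qed
  then have surj: "?h ` carrier ?E = carrier ?M"
    by (simp add: bool_mat_monoid_def flip: image_image)
  have inj: "inj_on ?h (carrier ?E)"
  proof (rule inj_onI)
    fix \<phi> \<psi> assume \<phi>: "\<phi> \<in> carrier ?E" and \<psi>: "\<psi> \<in> carrier ?E" and eq: "?h \<phi> = ?h \<psi>"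
    have ij: "x i \<in> gen_content \<phi> (x j) \<longleftrightarrow> x i \<in> gen_content \<psi> (x j)" if "i < n" "j < n" for i j
      using arg_cong[OF eq, of "\<lambda>A. A $$ (i, j)"] that unfolding h by simp
    show "\<phi> = \<psi>"
    proof (rule End_eqI[OF \<phi> \<psi>])
      fix v assume v: "v \<in> verts \<Theta>"
      then obtain j where j: "j < n" "v = x j" using verts by auto
      \<comment> \<open>Contents lie in the vertex set, so the matrix entries determine
        them.\<close>
      show "gen_content \<phi> v = gen_content \<psi> v"
      proof (rule Set.set_eqI)
        fix u
        show "u \<in> gen_content \<phi> v \<longleftrightarrow> u \<in> gen_content \<psi> v"
        proof (cases "u \<in> verts \<Theta>")
          case True
          then obtain i where "i < n" "u = x i" using verts by auto
          with j show ?thesis using ij by simp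
        next
          case False
          with sub[OF \<phi> v] sub[OF \<psi> v] show ?thesis by auto
        qed
      qed
    qed
  qed
  have mult: "?h (\<psi> \<otimes>\<^bsub>?E\<^esub> \<phi>) = ?h \<psi> \<otimes>\<^bsub>?M\<^esub> ?h \<phi>"
    if \<psi>: "\<psi> \<in> carrier ?E" and \<phi>: "\<phi> \<in> carrier ?E" for \<psi> \<phi>
  proof -
    \<comment> \<open>Column \<open>j\<close> describes the image of \<open>x j\<close>, so the
      composition of \<psi> after \<phi> corresponds to the product with the matrix of \<psi> on the
      left.\<close>
    have "x i \<in> gen_content (\<psi> \<otimes>\<^bsub>?E\<^esub> \<phi>) (x j) \<longleftrightarrow>
        (\<exists>k<n. x i \<in> gen_content \<psi> (x k) \<and> x k \<in> gen_content \<phi> (x j))" if "j < n" for i j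
    proof -
      have "x i \<in> gen_content (\<psi> \<otimes>\<^bsub>?E\<^esub> \<phi>) (x j) \<longleftrightarrow>
          (\<exists>u\<in>verts \<Theta>. x i \<in> gen_content \<psi> u \<and> u \<in> gen_content \<phi> (x j))"
        using sub[OF \<phi> xV[OF that]] by (auto simp: gen_content_mult[OF \<psi> \<phi> xV[OF that]])
      then show ?thesis by (auto simp: verts)
    qed
    then have "?h (\<psi> \<otimes>\<^bsub>?E\<^esub> \<phi>) = bool_mat_mult (?h \<psi>) (?h \<phi>)"
      unfolding h bool_mat_mult_def by (intro eq_matI) (simp_all cong: conj_cong)
    then show ?thesis by (simp add: bool_mat_monoid_def)
  qed
  have hom: "?h \<in> hom ?E ?M"
    by (rule homI) (use surj mult in blast)+
  have one: "?h \<one>\<^bsub>?E\<^esub> = \<one>\<^bsub>?M\<^esub>"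
    unfolding h by (auto simp: bool_mat_monoid_def bool_mat_one_def gen_content_one xV x_eq)
  show ?thesis
    using E.surj_hom_imp_monoid[OF hom surj one] hom one inj surj
    by (auto simp: iso_def bij_betw_def)
qed

end
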